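(* Let $m,N\in\mathbb{N}$ with $N\ge 2$ and $1\le m<N$. Let $\varepsilon\in(0,\tfrac14)$ and $\lambda\in(0,\tfrac54)\cap\mathbb{Q}$ be fixed. Consider the set-valued maps on $(A,y)\in\mathbb{C}^{m\times N}\times\mathbb{C}^m$ $$\Xi_{\mathrm{BP},m,N}(A,y,\varepsilon)=\operatorname*{arg\,min}_{x\in\mathbb{C}^N}\|x\|_{\ell_1}\ \text{ such that }\ \|Ax-y\|_{\ell_2}\le\varepsilon,$$ $$\Xi_{\mathrm{Lasso},m,N}(A,y,\lambda)=\operatorname*{arg\,min}_{x\in\mathbb{C}^N}\ \lambda\|x\|_{\ell_1}+\|Ax-y\|_{\ell_2}.$$ Then, in the Turing model, there does not exist a transparent algorithm solving the problem described by $\Xi_{\mathrm{BP},m,N}(\cdot,\cdot,\varepsilon)$, and there does not exist a transparent algorithm solving the problem described by $\Xi_{\mathrm{Lasso},m,N}(\cdot,\cdot,\lambda)$.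
   Context: For a set-valued map $f:\mathcal{V}\rightrightarrows\mathcal{Z}$, let $\mathrm{dom}(f)$ be the set of $v$ with $f(v)\neq\emptyset$, and let $\mathcal{M}_f$ be the set of all single-valued functions $f^s:\mathrm{dom}(f)\to\mathcal{Z}$ with $f^s(v)\in f(v)$ for all $v\in\mathrm{dom}(f)$. A transparent algorithm solving the problem described by $f$ in the Turing model is an algorithm with a transparent implementation in the Turing model that realizes some $f^s\in\mathcal{M}_f$ (the problem is solved by computing, for each input, one element of the solution set; which one is irrelevant). A sequence $(r_k)_{k\in\mathbb{N}}\subset\mathbb{Q}$ is computable if there are recursive functions $a,b,s:\mathbb{N}\to\mathbb{N}$ with $b(k)\neq0$ and $r_k=(-1)^{s(k)}a(k)/b(k)$ for all $k$. A representation of a real number $x$ is a computable rational sequence with $|r_k-x|\le2^{-k}$ for all $k$; real numbers having a representation are called computable. For vectors, matrices and complex numbers, these notions are applied componentwise and to real and imaginary parts; only inputs having a representation are admissible. A Turing machine TM operating on such data is identified with a mapping $\Psi_{\mathrm{TM}}$ from representations of inputs to rational sequences: TM has query access to the input representation (itself given by a Turing machine that returns $r_k$ when queried with precision $k$) and computes the terms of the output sequence. An algorithm given by TM realizes a function $g$ if for every admissible input $v$ in the domain of $g$ and every representation $r$ of $v$, $\Psi_{\mathrm{TM}}(r)$ is a representation of $g(v)$. The implementation is transparent if for any two representations of the same admissible input $v$ in the domain of $g$ the two output sequences represent the same element, i.e. the outcome depends only on $v$ and not on its representation. *)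

theory Defs
  imports Complex_Main "HOL-Library.FuncSet" "Jordan_Normal_Form.Matrix"
begin

section \<open>Computable numbers\<close>

text \<open>Total recursive functions of a given arity, arguments being passed as a list of that length.
  Minimisation is only applied to functions for which the search always succeeds.\<close>

inductive recursive_on :: "nat \<Rightarrow> (nat list \<Rightarrow> nat) \<Rightarrow> bool" where
  zero: "recursive_on n (\<lambda>xs. 0)"
| succ: "recursive_on 1 (\<lambda>xs. Suc (xs ! 0))"
| proj: "i < n \<Longrightarrow> recursive_on n (\<lambda>xs. xs ! i)"
| comp: "recursive_on (length gs) f \<Longrightarrow> (\<And>g. g \<in> set gs \<Longrightarrow> recursive_on n g)
    \<Longrightarrow> recursive_on n (\<lambda>xs. f (map (\<lambda>g. g xs) gs))"
| prec: "recursive_on n f \<Longrightarrow> recursive_on (Suc (Suc n)) g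
    \<Longrightarrow> recursive_on (Suc n) (\<lambda>xs. rec_nat (f (tl xs)) (\<lambda>k v. g (k # v # tl xs)) (hd xs))"
| minim: "recursive_on (Suc n) f \<Longrightarrow> (\<And>xs. length xs = n \<Longrightarrow> \<exists>y. f (y # xs) = 0)
    \<Longrightarrow> recursive_on n (\<lambda>xs. LEAST y. f (y # xs) = 0)"

definition recursive :: "(nat \<Rightarrow> nat) \<Rightarrow> bool" where
  "recursive h \<longleftrightarrow> (\<exists>f. recursive_on 1 f \<and> (\<forall>k. h k = f [k]))"

definition computable_seq :: "(nat \<Rightarrow> rat) \<Rightarrow> bool" where
  "computable_seq r \<longleftrightarrow> (\<exists>a b s. recursive a \<and> recursive b \<and> recursive s \<and>
     (\<forall>k. b k \<noteq> 0 \<and> r k = (-1) ^ s k * of_nat (a k) / of_nat (b k)))"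

definition represents :: "(nat \<Rightarrow> rat) \<Rightarrow> real \<Rightarrow> bool" where
  "represents r x \<longleftrightarrow> computable_seq r \<and> (\<forall>k. \<bar>of_rat (r k) - x\<bar> \<le> 1 / 2 ^ k)"

text \<open>Vectors, matrices and complex numbers are represented componentwise. They are
  identified with the lists of the real and imaginary parts of their entries
  (matrices row by row).\<close>

abbreviation represents_list :: "(nat \<Rightarrow> rat) list \<Rightarrow> real list \<Rightarrow> bool" where
  "represents_list \<equiv> list_all2 represents"

definition vec_coords :: "complex vec \<Rightarrow> real list" where
  "vec_coords v = concat (map (\<lambda>z. [Re z, Im z]) (list_of_vec v))"

definition mat_coords :: "complex mat \<Rightarrow> real list" where
  "mat_coords A = concat (map vec_coords (rows A))"

definition input_coords :: "complex mat \<times> complex vec \<Rightarrow> real list" where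
  "input_coords = (\<lambda>(A, y). mat_coords A @ vec_coords y)"


section \<open>Turing machines with query access to representations\<close>

text \<open>Tape symbols are natural numbers: 0 is the blank, 1 a tally mark, 2 a separator; further
  symbols are available to the machine. Numbers on tapes are written in unary, each
  number being followed by a separator.\<close>

definition encode :: "nat list \<Rightarrow> nat list" where
  "encode ns = concat (map (\<lambda>n. replicate n 1 @ [2]) ns)"

text \<open>The first argument counts the tally marks seen since the last separator.\<close>

fun decode :: "nat \<Rightarrow> nat list \<Rightarrow> nat list option" where
  "decode n [] = (if n = 0 then Some [] else None)"
| "decode n (c # w) =
     (if c = 1 then decode (Suc n) w
      else if c = 2 then map_option (Cons n) (decode 0 w)
      else None)"

lemma decode_encode: "decode 0 (encode ns) = Some ns"
proof -
  have tally: "decode k (replicate n 1 @ w) = decode (k + n) w" for k n w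
    by (induction n arbitrary: k) auto
  show ?thesis
    by (induction ns) (simp_all add: encode_def tally[simplified])
qed

text \<open>Rationals are written as a sign (0 or 1), a numerator and a denominator. Oracle answers
  use the reduced fraction and so depend only on the rational number; a machine's
  output need not be reduced.\<close>

definition encode_rat :: "rat \<Rightarrow> nat list" where
  "encode_rat q = (case quotient_of q of (a, b) \<Rightarrow>
     encode [if a < 0 then 1 else 0, nat \<bar>a\<bar>, nat b])"

definition decode_rat :: "nat list \<Rightarrow> rat option" where
  "decode_rat w = (case decode 0 w of
     Some [s, a, b] \<Rightarrow> (if b = 0 then None else Some ((-1) ^ s * of_nat a / of_nat b))
   | _ \<Rightarrow> None)"

text \<open>The query \<open>(i, k)\<close> returns the \<open>k\<close>-th term of the sequence representing the \<open>i\<close>-th real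
  coordinate of the input. Ill-formed queries are answered by the empty word.\<close>

definition answer :: "(nat \<Rightarrow> rat) list \<Rightarrow> nat list \<Rightarrow> nat list" where
  "answer rs w = (case decode 0 w of
     Some [i, k] \<Rightarrow> (if i < length rs then encode_rat ((rs ! i) k) else [])
   | _ \<Rightarrow> [])"

text \<open>A two-way infinite tape: the cells left of the head, nearest first, and the cells from
  the head onwards; all cells beyond the ends of the lists are blank.\<close>

type_synonym tape = "nat list \<times> nat list"

datatype move = MoveL | Stay | MoveR

definition scanned :: "tape \<Rightarrow> nat" where
  "scanned t = (case snd t of [] \<Rightarrow> 0 | c # _ \<Rightarrow> c)"

fun write_move :: "nat \<Rightarrow> move \<Rightarrow> tape \<Rightarrow> tape" where
  "write_move c Stay (l, r) = (l, c # tl r)"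
| "write_move c MoveR (l, r) = (c # l, tl r)"
| "write_move c MoveL (l, r) = (tl l, scanned ([], l) # c # tl r)"

definition tape_word :: "tape \<Rightarrow> nat list" where
  "tape_word t = takeWhile (\<lambda>c. c \<noteq> 0) (snd t)"

text \<open>A machine with a work tape and a query tape is a finite transition table, mapping a state
  and the two scanned symbols to a new state and, for each tape, a symbol to write and a
  head movement. As the table is finite, only finitely many states and
  symbols occur. The machine halts when no entry applies. State 0 is the initial
  state. In state 1 the table is not consulted: the content of the query tape is replaced by
  the answer to the word on it, and the machine goes to state 2. The word on a tape, as a query
  or as the final output on the work tape, extends from the head to the first blank.\<close>

type_synonym machine =
  "((nat \<times> nat \<times> nat) \<times> (nat \<times> nat \<times> move \<times> nat \<times> move)) list"

type_synonym config = "nat \<times> tape \<times> tape"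

definition step :: "machine \<Rightarrow> (nat \<Rightarrow> rat) list \<Rightarrow> config \<Rightarrow> config option" where
  "step M rs = (\<lambda>(p, t, u).
     if p = 1 then Some (2, t, ([], answer rs (tape_word u)))
     else (case map_of M (p, scanned t, scanned u) of
        None \<Rightarrow> None
      | Some (p', c, d, c', d') \<Rightarrow> Some (p', write_move c d t, write_move c' d' u)))"

text \<open>The final configuration of a halting computation; \<^term>\<open>None\<close> if the machine does not halt.\<close>

partial_function (option) run :: "machine \<Rightarrow> (nat \<Rightarrow> rat) list \<Rightarrow> config \<Rightarrow> config option" where
  "run M rs c = (case step M rs c of None \<Rightarrow> Some c | Some c' \<Rightarrow> run M rs c')"

text \<open>The \<open>k\<close>-th term of the sequence computed for the \<open>j\<close>-th real coordinate of the output.\<close>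

definition out_term :: "machine \<Rightarrow> (nat \<Rightarrow> rat) list \<Rightarrow> nat \<Rightarrow> nat \<Rightarrow> rat option" where
  "out_term M rs j k = (case run M rs (0, ([], encode [j, k]), ([], [])) of
     None \<Rightarrow> None
   | Some (p, t, u) \<Rightarrow> decode_rat (tape_word t))"

text \<open>The mapping from input representations to tuples of rational sequences associated with \<open>M\<close>,
  where \<open>n\<close> is the number of real coordinates of the output; it is undefined if some
  term is not computed.\<close>

definition Psi :: "nat \<Rightarrow> machine \<Rightarrow> (nat \<Rightarrow> rat) list \<Rightarrow> (nat \<Rightarrow> rat) list option" where
  "Psi n M rs = (if \<forall>j<n. \<forall>k. out_term M rs j k \<noteq> None
     then Some (map (\<lambda>j k. the (out_term M rs j k)) [0..<n]) else None)"


section \<open>Transparent algorithms\<close>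

text \<open>In the following, \<open>cV\<close> and \<open>cZ\<close> give the real coordinates of inputs and outputs, and \<open>n\<close> is the
  number of the latter. Admissible inputs are those having a representation.\<close>

definition realizes ::
  "('v \<Rightarrow> real list) \<Rightarrow> ('z \<Rightarrow> real list) \<Rightarrow> nat \<Rightarrow> machine \<Rightarrow> 'v set \<Rightarrow> ('v \<Rightarrow> 'z) \<Rightarrow> bool" where
  "realizes cV cZ n M D g \<longleftrightarrow> (\<forall>v\<in>D. \<forall>rs. represents_list rs (cV v) \<longrightarrow>
     (\<exists>qs. Psi n M rs = Some qs \<and> represents_list qs (cZ (g v))))"

definition transparent ::
  "('v \<Rightarrow> real list) \<Rightarrow> ('z \<Rightarrow> real list) \<Rightarrow> nat \<Rightarrow> machine \<Rightarrow> 'v set \<Rightarrow> bool" where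
  "transparent cV cZ n M D \<longleftrightarrow> (\<forall>v\<in>D. \<forall>rs rs'.
     represents_list rs (cV v) \<and> represents_list rs' (cV v) \<longrightarrow>
     (\<exists>z qs qs'. Psi n M rs = Some qs \<and> Psi n M rs' = Some qs' \<and>
        represents_list qs (cZ z) \<and> represents_list qs' (cZ z)))"

definition set_dom :: "'v set \<Rightarrow> ('v \<Rightarrow> 'z set) \<Rightarrow> 'v set" where
  "set_dom V f = {v \<in> V. f v \<noteq> {}}"

definition selections :: "'v set \<Rightarrow> ('v \<Rightarrow> 'z set) \<Rightarrow> ('v \<Rightarrow> 'z) set" where
  "selections V f = (\<Pi>\<^sub>E v\<in>set_dom V f. f v)"

definition transparently_solves ::
  "('v \<Rightarrow> real list) \<Rightarrow> ('z \<Rightarrow> real list) \<Rightarrow> nat \<Rightarrow> machine \<Rightarrow> 'v set \<Rightarrow> ('v \<Rightarrow> 'z set) \<Rightarrow> bool" where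
  "transparently_solves cV cZ n M V f \<longleftrightarrow> transparent cV cZ n M (set_dom V f) \<and>
     (\<exists>g\<in>selections V f. realizes cV cZ n M (set_dom V f) g)"


section \<open>Basis pursuit and Lasso\<close>

definition l1_norm :: "complex vec \<Rightarrow> real" where
  "l1_norm x = (\<Sum>i<dim_vec x. cmod (x $ i))"

definition l2_norm :: "complex vec \<Rightarrow> real" where
  "l2_norm x = sqrt (\<Sum>i<dim_vec x. (cmod (x $ i))\<^sup>2)"

definition problem_inputs :: "nat \<Rightarrow> nat \<Rightarrow> (complex mat \<times> complex vec) set" where
  "problem_inputs m N = carrier_mat m N \<times> carrier_vec m"

definition Xi_BP :: "nat \<Rightarrow> real \<Rightarrow> complex mat \<times> complex vec \<Rightarrow> complex vec set" where
  "Xi_BP N \<epsilon> = (\<lambda>(A, y).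
     {x. is_arg_min l1_norm (\<lambda>x. x \<in> carrier_vec N \<and> l2_norm (A *\<^sub>v x - y) \<le> \<epsilon>) x})"

definition Xi_Lasso :: "nat \<Rightarrow> real \<Rightarrow> complex mat \<times> complex vec \<Rightarrow> complex vec set" where
  "Xi_Lasso N lam = (\<lambda>(A, y).
     {x. is_arg_min (\<lambda>x. lam * l1_norm x + l2_norm (A *\<^sub>v x - y)) (\<lambda>x. x \<in> carrier_vec N) x})"

end

theory Submission
  imports Defs
begin

text \<open>A halting computation consults only finitely many terms of the representation of its
  input, so a realized function is continuous at every rational input: a nearby rational input
  has a representation that starts with the constant terms of the former. On the other hand,
  let the first row of \<open>A\<close> be \<open>(2, 2, 0, \<dots>, 0)\<close>, let the other rows be zero, and let
  \<open>y = (1, 0, \<dots>, 0)\<close>. Increasing one of the entries 2 by an arbitrarily small amount forces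
  every solution to be concentrated on that column, with a mass bounded away from 0.\<close>

section \<open>Eventually constant rational sequences\<close>

lemma recursive_on_const: "recursive_on n (\<lambda>_. c)"
proof (induction c)
  case 0
  show ?case by (rule recursive_on.zero)
next
  case (Suc c)
  have "recursive_on n (\<lambda>xs. (\<lambda>xs. Suc (xs ! 0)) (map (\<lambda>g. g xs) [\<lambda>_. c]))"
    by (rule recursive_on.comp) (use Suc recursive_on.succ in auto)
  then show ?case by simp
qed

lemma recursive_const: "recursive (\<lambda>_. c)"
  unfolding recursive_def using recursive_on_const by blast

text \<open>Prepending a value is primitive recursion whose step ignores the accumulated value: at
  \<open>Suc k\<close> it returns \<open>h k\<close>, read off the recursion counter.\<close>

lemma recursive_case_nat:
  assumes "recursive h"
  shows "recursive (case_nat c h)"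
proof -
  obtain f where f: "recursive_on 1 f" "\<And>k. h k = f [k]"
    using assms unfolding recursive_def by blast
  have "recursive_on (Suc (Suc 0)) (\<lambda>xs. f (map (\<lambda>g. g xs) [\<lambda>xs. xs ! 0]))"
    by (rule recursive_on.comp) (use f recursive_on.proj[of 0 "Suc (Suc 0)"] in auto)
  from recursive_on.prec[OF recursive_on_const[of 0 c] this]
  have "recursive_on 1 (\<lambda>xs. rec_nat c (\<lambda>k v. f [k]) (hd xs))"
    by simp
  moreover have "case_nat c h k = (\<lambda>xs. rec_nat c (\<lambda>k v. f [k]) (hd xs)) [k]" for k
    using f(2) by (cases k) auto
  ultimately show ?thesis
    unfolding recursive_def by blast
qed

text \<open>Prepending \<open>c\<close> to the constant \<open>d\<close> once for
  \<open>n = 0\<close>, and once more for each step of \<open>n\<close>, yields the case distinction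
  without showing that comparison is recursive.\<close>

lemma recursive_threshold: "recursive (\<lambda>k. if k \<le> n then c else d)"
proof (induction n)
  case 0
  have "(\<lambda>k. if k \<le> 0 then c else d) = case_nat c (\<lambda>_. d)"
    by (auto simp: fun_eq_iff split: nat.split)
  then show ?case by (simp add: recursive_case_nat recursive_const)
next
  case (Suc n)
  have "(\<lambda>k. if k \<le> Suc n then c else d) = case_nat c (\<lambda>k. if k \<le> n then c else d)"
    by (auto simp: fun_eq_iff split: nat.split)
  then show ?case using recursive_case_nat[OF Suc] by simp
qed

lemma rat_sign_fraction:
  fixes q :: rat
  obtains s a b :: nat where "b \<noteq> 0" "q = (-1) ^ s * of_nat a / of_nat b"
proof -
  obtain i j where q: "quotient_of q = (i, j)" by (cases "quotient_of q")
  then have j: "j > 0" and qij: "q = of_int i / of_int j"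
    by (auto simp: quotient_of_denom_pos quotient_of_div)
  have "q = (-1) ^ (if i < 0 then 1 else 0) * of_nat (nat \<bar>i\<bar>) / of_nat (nat j)"
    using j by (simp add: qij of_nat_nat)
  moreover have "nat j \<noteq> 0" using j by simp
  ultimately show ?thesis using that by blast
qed

lemma computable_seq_threshold: "computable_seq (\<lambda>k. if k \<le> n then q else q')"
proof -
  obtain s a b where q: "b \<noteq> 0" "q = (-1) ^ s * of_nat a / of_nat b"
    by (rule rat_sign_fraction)
  obtain s' a' b' where q': "b' \<noteq> 0" "q' = (-1) ^ s' * of_nat a' / of_nat b'"
    by (rule rat_sign_fraction)
  show ?thesis
    unfolding computable_seq_def
    by (rule exI[of _ "\<lambda>k. if k \<le> n then a else a'"], rule exI[of _ "\<lambda>k. if k \<le> n then b else b'"],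
        rule exI[of _ "\<lambda>k. if k \<le> n then s else s'"])
      (use q q' in \<open>auto simp: recursive_threshold\<close>)
qed

text \<open>The tolerance shrinks with the index, so closeness at \<open>n\<close> covers all
  earlier terms. The sequence imitates the constant representation of \<open>q\<close> up to
  \<open>n\<close> and yet represents \<open>q'\<close>.\<close>

lemma represents_threshold:
  assumes "\<bar>of_rat q - of_rat q'\<bar> \<le> (1 / 2 ^ n :: real)"
  shows "represents (\<lambda>k. if k \<le> n then q else q') (of_rat q')"
proof -
  have "\<bar>of_rat q - of_rat q'\<bar> \<le> (1 / 2 ^ k :: real)" if "k \<le> n" for k
  proof -
    have "1 / 2 ^ n \<le> (1 / 2 ^ k :: real)"
      using that by (simp add: frac_le power_increasing)
    with assms show ?thesis by linarith
  qed
  then show ?thesis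
    unfolding represents_def by (auto simp: computable_seq_threshold)
qed


section \<open>Continuity of realized functions\<close>

text \<open>A well-formed query reads a single term, whose index serves as \<open>K\<close>; every
  other query gets the empty word. The relation \<open>list_all2\<close> also fixes the number of
  coordinates, on which the answer depends.\<close>

lemma answer_finite_use:
  "\<exists>K. \<forall>rs'. list_all2 (\<lambda>r r'. \<forall>k\<le>K. r k = r' k) rs rs' \<longrightarrow> answer rs' w = answer rs w"
proof (cases "\<exists>i k. decode 0 w = Some [i, k]")
  case True
  then obtain i k where w: "decode 0 w = Some [i, k]" by blast
  show ?thesis
    by (rule exI[of _ k]) (auto simp: answer_def w list_all2_conv_all_nth)
next
  case False
  then have "answer rs' w = answer rs w" for rs'
    by (auto simp: answer_def split: option.split list.split)
  then show ?thesis by blast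
qed

lemma step_finite_use:
  "\<exists>K. \<forall>rs'. list_all2 (\<lambda>r r'. \<forall>k\<le>K. r k = r' k) rs rs' \<longrightarrow> step M rs' c = step M rs c"
proof -
  obtain p t u where fields: "c = (p, t, u)" by (metis prod_cases3)
  obtain K where "\<forall>rs'. list_all2 (\<lambda>r r'. \<forall>k\<le>K. r k = r' k) rs rs'
      \<longrightarrow> answer rs' (tape_word u) = answer rs (tape_word u)"
    using answer_finite_use by blast
  then have "\<forall>rs'. list_all2 (\<lambda>r r'. \<forall>k\<le>K. r k = r' k) rs rs' \<longrightarrow> step M rs' c = step M rs c"
    by (simp add: step_def fields)
  then show ?thesis by blast
qed

text \<open>A halting run has finitely many steps, so the maximum of their bounds works for the
  whole run.\<close>

lemma run_finite_use:
  assumes "run M rs c = Some d"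
  shows "\<exists>K. \<forall>rs'. list_all2 (\<lambda>r r'. \<forall>k\<le>K. r k = r' k) rs rs' \<longrightarrow> run M rs' c = Some d"
\<comment> \<open>Fixpoint induction: \<open>run'\<close> approximates \<open>run\<close>, and a
  defined result of \<open>run'\<close> transfers to \<open>run\<close> for every agreeing
  representation.\<close>
proof (rule run.raw_induct[OF _ assms])
  fix run' M rs c and d :: config
  assume IH: "\<And>M rs c d. run' M rs c = Some d
      \<Longrightarrow> \<exists>K. \<forall>rs'. list_all2 (\<lambda>r r'. \<forall>k\<le>K. r k = r' k) rs rs' \<longrightarrow> run M rs' c = Some d"
    and d: "(case step M rs c of None \<Rightarrow> Some c | Some c' \<Rightarrow> run' M rs c') = Some d"
  obtain K where K: "\<And>rs'. list_all2 (\<lambda>r r'. \<forall>k\<le>K. r k = r' k) rs rs'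
      \<Longrightarrow> step M rs' c = step M rs c"
    using step_finite_use by meson
  show "\<exists>K. \<forall>rs'. list_all2 (\<lambda>r r'. \<forall>k\<le>K. r k = r' k) rs rs' \<longrightarrow> run M rs' c = Some d"
  proof (cases "step M rs c")
    case None
    then have "run M rs' c = Some d" if "list_all2 (\<lambda>r r'. \<forall>k\<le>K. r k = r' k) rs rs'" for rs'
      using d K[OF that] by (simp add: run.simps)
    then show ?thesis by blast
  next
    case (Some c')
    then have "run' M rs c' = Some d" using d by simp
    from IH[OF this] obtain K' where
      K': "\<And>rs'. list_all2 (\<lambda>r r'. \<forall>k\<le>K'. r k = r' k) rs rs' \<Longrightarrow> run M rs' c' = Some d"
      by blast
    have "run M rs' c = Some d" if *: "list_all2 (\<lambda>r r'. \<forall>k\<le>max K K'. r k = r' k) rs rs'" for rs'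
    proof -
      have "step M rs' c = Some c'"
        using K[OF list_all2_mono[OF *]] Some by simp
      moreover have "run M rs' c' = Some d"
        using K'[OF list_all2_mono[OF *]] by simp
      ultimately show ?thesis by (simp add: run.simps)
    qed
    then show ?thesis by blast
  qed
qed

lemma out_term_finite_use:
  assumes "out_term M rs j k = Some q"
  shows "\<exists>K. \<forall>rs'. list_all2 (\<lambda>r r'. \<forall>k\<le>K. r k = r' k) rs rs' \<longrightarrow> out_term M rs' j k = Some q"
proof -
  obtain d where d: "run M rs (0, ([], encode [j, k]), ([], [])) = Some d"
    using assms unfolding out_term_def by (auto split: option.splits)
  from run_finite_use[OF d] obtain K where "\<And>rs'. list_all2 (\<lambda>r r'. \<forall>k\<le>K. r k = r' k) rs rs'
      \<Longrightarrow> run M rs' (0, ([], encode [j, k]), ([], [])) = Some d"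
    by blast
  then have "out_term M rs' j k = Some q" if "list_all2 (\<lambda>r r'. \<forall>k\<le>K. r k = r' k) rs rs'" for rs'
    using that assms d unfolding out_term_def by simp
  then show ?thesis by blast
qed

lemma realizes_out_term:
  assumes "realizes cV cZ n M D g" "v \<in> D" "represents_list rs (cV v)" "j < n"
  obtains q where "out_term M rs j k = Some q" "\<bar>of_rat q - cZ (g v) ! j\<bar> \<le> 1 / 2 ^ k"
proof -
  obtain qs where qs: "Psi n M rs = Some qs" "represents_list qs (cZ (g v))"
    using assms unfolding realizes_def by blast
  then have "out_term M rs j k \<noteq> None" "qs = map (\<lambda>j k. the (out_term M rs j k)) [0..<n]"
    using assms(4) unfolding Psi_def by (auto split: if_splits)
  then have "length qs = n" "out_term M rs j k = Some ((qs ! j) k)"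
    using assms(4) by auto
  moreover from this have "represents (qs ! j) (cZ (g v) ! j)"
    using qs(2) assms(4) by (auto simp: list_all2_conv_all_nth)
  ultimately show ?thesis
    using that unfolding represents_def by blast
qed

text \<open>One output \<open>q\<close>, computed from finitely many terms, approximates the values
  at both inputs, so these differ by at most twice its error. Nearby inputs are taken rational as
  well, which makes their modified representations eventually constant and hence computable.\<close>

lemma realized_continuous_at_rational:
  assumes g: "realizes cV cZ n M D g" and v: "v \<in> D" "set (cV v) \<subseteq> \<rat>" and j: "j < n" and e: "0 < e"
  shows "\<exists>K. \<forall>v'\<in>D. list_all2 (\<lambda>x x'. x' \<in> \<rat> \<and> \<bar>x - x'\<bar> \<le> 1 / 2 ^ K) (cV v) (cV v')
    \<longrightarrow> \<bar>cZ (g v') ! j - cZ (g v) ! j\<bar> \<le> e"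
proof -
  \<comment> \<open>A right inverse of \<open>of_rat\<close> on the rationals, arbitrary
    elsewhere.\<close>
  define rat where "rat x = (SOME q. of_rat q = x)" for x :: real
  have rat: "of_rat (rat x) = x" if "x \<in> \<rat>" for x
    unfolding rat_def by (rule someI_ex) (use that in \<open>auto elim: Rats_cases\<close>)
  obtain k where "(1 / 2) ^ k < e / 2"
    using real_arch_pow_inv[of "e / 2" "1 / 2"] e by auto
  then have k: "1 / 2 ^ k < e / 2" by (simp add: power_one_over)
  define rs :: "(nat \<Rightarrow> rat) list" where "rs = map (\<lambda>x k. rat x) (cV v)"
  have "represents (\<lambda>k. rat x) x" if "x \<in> \<rat>" for x
    using represents_threshold[of "rat x" "rat x" 0] rat[OF that] by simp
  then have "represents_list rs (cV v)"
    using v(2) by (auto simp: rs_def list_all2_conv_all_nth subset_iff)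
  then obtain q where q: "out_term M rs j k = Some q" "\<bar>of_rat q - cZ (g v) ! j\<bar> \<le> 1 / 2 ^ k"
    using realizes_out_term[OF g v(1) _ j] by blast
  obtain K where K: "\<And>rs'. list_all2 (\<lambda>r r'. \<forall>k\<le>K. r k = r' k) rs rs'
      \<Longrightarrow> out_term M rs' j k = Some q"
    using out_term_finite_use[OF q(1)] by blast
  have "\<bar>cZ (g v') ! j - cZ (g v) ! j\<bar> \<le> e"
    if v': "v' \<in> D" and near: "list_all2 (\<lambda>x x'. x' \<in> \<rat> \<and> \<bar>x - x'\<bar> \<le> 1 / 2 ^ K) (cV v) (cV v')" for v'
  proof -
    \<comment> \<open>Agrees with \<open>rs\<close> on the terms up to \<open>K\<close>, which
      already determine the output \<open>q\<close>, and is exact for \<open>v'\<close>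
      afterwards.\<close>
    define rs' :: "(nat \<Rightarrow> rat) list" where
      "rs' = map2 (\<lambda>x x' k. if k \<le> K then rat x else rat x') (cV v) (cV v')"
    have "represents (\<lambda>k. if k \<le> K then rat x else rat x') x'"
      if "x \<in> \<rat>" "x' \<in> \<rat>" "\<bar>x - x'\<bar> \<le> 1 / 2 ^ K" for x x'
      using represents_threshold[of "rat x" "rat x'" K] that by (simp add: rat)
    then have "represents_list rs' (cV v')"
      using v(2) near by (auto simp: rs'_def list_all2_conv_all_nth subset_iff)
    then obtain q' where q': "out_term M rs' j k = Some q'" "\<bar>of_rat q' - cZ (g v') ! j\<bar> \<le> 1 / 2 ^ k"
      using realizes_out_term[OF g v' _ j] by blast
    have "list_all2 (\<lambda>r r'. \<forall>k\<le>K. r k = r' k) rs rs'"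
      using near by (auto simp: rs_def rs'_def list_all2_conv_all_nth)
    with K q'(1) have "q' = q" by simp
    with q'(2) have "\<bar>of_rat q - cZ (g v') ! j\<bar> \<le> 1 / 2 ^ k" by simp
    with q(2) k show ?thesis by linarith
  qed
  then show ?thesis by blast
qed


section \<open>Problems with a single nonzero row\<close>

definition row_mat :: "nat \<Rightarrow> nat \<Rightarrow> (nat \<Rightarrow> real) \<Rightarrow> complex mat" where
  "row_mat m N c = mat m N (\<lambda>(i, j). if i = 0 then of_real (c j) else 0)"

lemma list_all2_concat:
  "list_all2 (list_all2 P) xss yss \<Longrightarrow> list_all2 P (concat xss) (concat yss)"
  by (induction rule: list_all2_induct) (auto intro: list_all2_appendI)

lemma list_all2_vec_coords:
  assumes "dim_vec v = dim_vec w"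
    and "\<And>i. i < dim_vec v \<Longrightarrow> P (Re (v $ i)) (Re (w $ i)) \<and> P (Im (v $ i)) (Im (w $ i))"
  shows "list_all2 P (vec_coords v) (vec_coords w)"
proof -
  have "list_all2 (\<lambda>z z'. P (Re z) (Re z') \<and> P (Im z) (Im z')) (list_of_vec v) (list_of_vec w)"
    using assms by (simp add: list_all2_conv_all_nth list_of_vec_index)
  then show ?thesis
    unfolding vec_coords_def by (intro list_all2_concat) (simp add: list.rel_map)
qed

text \<open>Every real coordinate of such an input is an entry of the row, 0 or 1. The predicate
  \<open>P\<close> is instantiated with rationality and with closeness of inputs.\<close>

lemma list_all2_input_coords_row_mat:
  assumes "\<And>j. j < N \<Longrightarrow> P (c j) (c' j)" "P 0 0" "P 1 1"
  shows "list_all2 P (input_coords (row_mat m N c, unit_vec m 0)) (input_coords (row_mat m N c', unit_vec m 0))"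
proof -
  have "list_all2 P (mat_coords (row_mat m N c)) (mat_coords (row_mat m N c'))"
    unfolding mat_coords_def
  proof (rule list_all2_concat, unfold list.rel_map, rule list_all2_all_nthI)
    fix i assume "i < length (rows (row_mat m N c))"
    then have i: "i < m" by (simp add: row_mat_def)
    have "list_all2 P (vec_coords (row (row_mat m N c) i)) (vec_coords (row (row_mat m N c') i))"
      by (rule list_all2_vec_coords) (use assms i in \<open>auto simp: row_mat_def\<close>)
    then show "list_all2 P (vec_coords (rows (row_mat m N c) ! i)) (vec_coords (rows (row_mat m N c') ! i))"
      using i by (simp add: row_mat_def)
  qed (simp add: row_mat_def)
  moreover have "list_all2 P (vec_coords (unit_vec m 0)) (vec_coords (unit_vec m 0))"
    by (rule list_all2_vec_coords) (use assms in \<open>auto simp: unit_vec_def\<close>)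
  ultimately show ?thesis
    unfolding input_coords_def by (auto intro: list_all2_appendI)
qed

lemma l2_norm_nonneg: "0 \<le> l2_norm x"
  unfolding l2_norm_def by (simp add: sum_nonneg)

lemma l2_norm_row_mat:
  assumes "0 < m" "x \<in> carrier_vec N"
  shows "l2_norm (row_mat m N c *\<^sub>v x - unit_vec m 0) = cmod ((\<Sum>j<N. of_real (c j) * x $ j) - 1)"
proof -
  let ?s = "\<Sum>j<N. of_real (c j) * x $ j"
  have entry: "(row_mat m N c *\<^sub>v x - unit_vec m 0) $ i = (if i = 0 then ?s - 1 else 0)" if "i < m" for i
    using that assms(2) by (auto simp: row_mat_def scalar_prod_def atLeast0LessThan)
  have sq: "(cmod ((row_mat m N c *\<^sub>v x - unit_vec m 0) $ i))\<^sup>2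
      = (if i = 0 then (cmod (?s - 1))\<^sup>2 else 0)" if "i < m" for i
    by (simp only: entry[OF that] split: if_split) simp
  have "l2_norm (row_mat m N c *\<^sub>v x - unit_vec m 0)
      = sqrt (\<Sum>i<m. if i = 0 then (cmod (?s - 1))\<^sup>2 else 0)"
    unfolding l2_norm_def by (rule arg_cong[of _ _ sqrt], rule sum.cong) (simp_all only: sq lessThan_iff index_minus_vec(2) index_unit_vec(3))
  also have "\<dots> = cmod (?s - 1)"
    using assms(1) by (simp add: sum.delta)
  finally show ?thesis .
qed

text \<open>Triangle inequality, with the slack kept: for \<open>C = c p\<close> maximal, the second
  sum is the penalty for mass outside the best column, and it drives both uniqueness
  arguments.\<close>

lemma row_l1_bound:
  assumes "x \<in> carrier_vec N" "\<And>j. 0 \<le> c j"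
  shows "cmod (\<Sum>j<N. of_real (c j) * x $ j) + (\<Sum>j<N. (C - c j) * cmod (x $ j)) \<le> C * l1_norm x"
proof -
  have "cmod (\<Sum>j<N. of_real (c j) * x $ j) \<le> (\<Sum>j<N. c j * cmod (x $ j))"
    using assms(2) by (intro sum_norm_le) (simp add: norm_mult)
  moreover have "(\<Sum>j<N. c j * cmod (x $ j)) + (\<Sum>j<N. (C - c j) * cmod (x $ j)) = C * l1_norm x"
    using assms(1) by (simp add: l1_norm_def sum.distrib[symmetric] sum_distrib_left algebra_simps)
  ultimately show ?thesis by linarith
qed

text \<open>A sum of nonnegative terms that is at most 0 vanishes termwise, and the weights off
  \<open>p\<close> are positive.\<close>

lemma weighted_sum_nonpos_imp_zero:
  assumes "x \<in> carrier_vec N" "\<And>j. j \<noteq> p \<Longrightarrow> c j < c p"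
    and "(\<Sum>j<N. (c p - c j) * cmod (x $ j)) \<le> 0" "j < N" "j \<noteq> p"
  shows "x $ j = 0"
proof -
  have le: "c i \<le> c p" for i
    using assms(2)[of i] by (cases "i = p") auto
  have nn: "0 \<le> (c p - c i) * cmod (x $ i)" for i
    using le by simp
  have "(\<Sum>j<N. (c p - c j) * cmod (x $ j)) = 0"
    using assms(3) nn by (meson antisym sum_nonneg)
  then have "(c p - c j) * cmod (x $ j) = 0"
    using nn assms(4) by (subst (asm) sum_nonneg_eq_0_iff) auto
  with assms(2)[OF assms(5)] show ?thesis by simp
qed

lemma row_sum_unit:
  fixes x :: "complex vec"
  assumes "p < N" "\<And>j. j < N \<Longrightarrow> j \<noteq> p \<Longrightarrow> x $ j = 0"
  shows "(\<Sum>j<N. of_real (c j) * x $ j) = of_real (c p) * x $ p"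
proof -
  have "(\<Sum>j<N. of_real (c j) * x $ j) = (\<Sum>j<N. if j = p then of_real (c p) * x $ p else 0)"
    by (rule sum.cong) (use assms in auto)
  then show ?thesis using assms(1) by simp
qed

text \<open>Vectors with all mass on one column are the candidate minimisers in both
  problems.\<close>

lemma spike:
  fixes t :: real
  assumes "p < N" "0 \<le> t"
  defines "x \<equiv> of_real t \<cdot>\<^sub>v unit_vec N p"
  shows "x \<in> carrier_vec N" "l1_norm x = t"
    "(\<Sum>j<N. of_real (c j) * x $ j) = of_real (c p * t)"
proof -
  show "x \<in> carrier_vec N" by (simp add: x_def)
  have "l1_norm x = (\<Sum>j<N. if j = p then t else 0)"
    unfolding l1_norm_def by (rule sum.cong) (use assms(1,2) in \<open>auto simp: x_def\<close>)
  then show "l1_norm x = t" using assms(1) by simp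
  show "(\<Sum>j<N. of_real (c j) * x $ j) = of_real (c p * t)"
    using row_sum_unit[of p N x c] assms(1) by (simp add: x_def)
qed

section \<open>Rows whose largest entry is \<open>c p\<close>\<close>

context
  fixes m N p :: nat and c :: "nat \<Rightarrow> real"
  assumes m: "0 < m" and p: "p < N" and c_nonneg: "\<And>j. 0 \<le> c j" and c_le: "\<And>j. c j \<le> c p"
    and c_pos: "0 < c p"
begin

lemma excess_nonneg: "0 \<le> (\<Sum>j<N. (c p - c j) * cmod (x $ j))"
  using c_le by (intro sum_nonneg) simp

section \<open>Basis pursuit\<close>

context
  fixes \<epsilon> :: real
  assumes eps: "0 \<le> \<epsilon>" "\<epsilon> < 1"
begin

text \<open>The mass is chosen so that the row sum is \<open>1 - \<epsilon>\<close>, which exhausts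
  the allowed residual exactly.\<close>

lemma BP_spike_feasible:
  defines "z \<equiv> of_real ((1 - \<epsilon>) / c p) \<cdot>\<^sub>v unit_vec N p"
  shows "z \<in> carrier_vec N \<and> l2_norm (row_mat m N c *\<^sub>v z - unit_vec m 0) \<le> \<epsilon>"
    and "l1_norm z = (1 - \<epsilon>) / c p"
proof -
  have t: "0 \<le> (1 - \<epsilon>) / c p" using eps c_pos by simp
  note z = spike[OF p t, folded z_def]
  have "c p * ((1 - \<epsilon>) / c p) = 1 - \<epsilon>"
    using c_pos by simp
  then show "z \<in> carrier_vec N \<and> l2_norm (row_mat m N c *\<^sub>v z - unit_vec m 0) \<le> \<epsilon>"
    using z(1) z(3)[of c] eps by (simp only: l2_norm_row_mat[OF m z(1)]) simp
  show "l1_norm z = (1 - \<epsilon>) / c p" by (rule z(2))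
qed

text \<open>Feasibility keeps the row sum within \<epsilon> of 1, so its modulus is at least
  \<open>1 - \<epsilon>\<close>.\<close>

lemma BP_l1_bound:
  assumes "x \<in> carrier_vec N" "l2_norm (row_mat m N c *\<^sub>v x - unit_vec m 0) \<le> \<epsilon>"
  shows "1 - \<epsilon> + (\<Sum>j<N. (c p - c j) * cmod (x $ j)) \<le> c p * l1_norm x"
proof -
  let ?s = "\<Sum>j<N. of_real (c j) * x $ j"
  have "cmod (?s - 1) \<le> \<epsilon>" using assms by (simp add: l2_norm_row_mat[OF m])
  \<comment> \<open>The triangle inequality applied to \<open>?s - (?s - 1) = 1\<close>.\<close>
  moreover have "1 \<le> cmod ?s + cmod (?s - 1)"
    using norm_triangle_ineq4[of ?s "?s - 1"] by simp
  ultimately show ?thesis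
    using row_l1_bound[OF assms(1), where c = c and C = "c p"] c_nonneg by simp
qed

text \<open>The spike attains the lower bound for the norm. Ties for the maximum are allowed, so the
  unperturbed input lies in the domain too.\<close>

lemma Xi_BP_row_mat_nonempty: "Xi_BP N \<epsilon> (row_mat m N c, unit_vec m 0) \<noteq> {}"
proof -
  let ?z = "of_real ((1 - \<epsilon>) / c p) \<cdot>\<^sub>v unit_vec N p :: complex vec"
  have "l1_norm ?z \<le> l1_norm x"
    if "x \<in> carrier_vec N" "l2_norm (row_mat m N c *\<^sub>v x - unit_vec m 0) \<le> \<epsilon>" for x
  proof -
    have "1 - \<epsilon> \<le> l1_norm x * c p"
      using BP_l1_bound[OF that] excess_nonneg[of x] by (simp add: mult.commute)
    then show ?thesis
      unfolding BP_spike_feasible(2) using c_pos by (simp add: divide_le_eq)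
  qed
  then have "?z \<in> Xi_BP N \<epsilon> (row_mat m N c, unit_vec m 0)"
    using BP_spike_feasible(1) by (auto simp: Xi_BP_def is_arg_min_def not_less)
  then show ?thesis by blast
qed

text \<open>A minimiser is no longer than the spike, which leaves no room for the penalty; strict
  maximality then removes all other entries. The constraint on the remaining entry bounds its real
  part below.\<close>

lemma Xi_BP_row_mat_concentrated:
  assumes "\<And>j. j \<noteq> p \<Longrightarrow> c j < c p" and x: "x \<in> Xi_BP N \<epsilon> (row_mat m N c, unit_vec m 0)"
  shows "x \<in> carrier_vec N" "\<And>j. j < N \<Longrightarrow> j \<noteq> p \<Longrightarrow> x $ j = 0" "1 - \<epsilon> \<le> c p * Re (x $ p)"
proof -
  from x have feas: "x \<in> carrier_vec N" "l2_norm (row_mat m N c *\<^sub>v x - unit_vec m 0) \<le> \<epsilon>"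
    and "l1_norm x \<le> (1 - \<epsilon>) / c p"
    using BP_spike_feasible by (auto simp: Xi_BP_def is_arg_min_def not_less)
  then have "c p * l1_norm x \<le> 1 - \<epsilon>"
    using c_pos by (simp add: le_divide_eq mult.commute)
  with BP_l1_bound[OF feas] have "(\<Sum>j<N. (c p - c j) * cmod (x $ j)) \<le> 0"
    by linarith
  then show zero: "x $ j = 0" if "j < N" "j \<noteq> p" for j
    using weighted_sum_nonpos_imp_zero[OF feas(1)] assms(1) that by blast
  show "x \<in> carrier_vec N" by (rule feas(1))
  have "cmod (of_real (c p) * x $ p - 1) \<le> \<epsilon>"
    using feas row_sum_unit[OF p zero, of c] by (simp add: l2_norm_row_mat[OF m])
  then show "1 - \<epsilon> \<le> c p * Re (x $ p)"
    using abs_Re_le_cmod[of "of_real (c p) * x $ p - 1"] by simp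
qed

end

section \<open>Lasso\<close>

context
  fixes lam :: real
  assumes lam: "0 < lam" "lam < c p"
begin

text \<open>Mass \<open>1 / c p\<close> makes the row sum 1, so the residual vanishes.\<close>

lemma Lasso_spike_value:
  defines "z \<equiv> of_real (1 / c p) \<cdot>\<^sub>v unit_vec N p"
  shows "z \<in> carrier_vec N"
    and "lam * l1_norm z + l2_norm (row_mat m N c *\<^sub>v z - unit_vec m 0) = lam / c p"
proof -
  have t: "0 \<le> 1 / c p" using c_pos by simp
  note z = spike[OF p t, folded z_def]
  show "z \<in> carrier_vec N" by (rule z(1))
  show "lam * l1_norm z + l2_norm (row_mat m N c *\<^sub>v z - unit_vec m 0) = lam / c p"
    using z(2) z(3)[of c] c_pos by (simp add: l2_norm_row_mat[OF m z(1)])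
qed

text \<open>The fraction \<open>lam / c p\<close> of the residual already compensates the gain in the
  \<open>\<ell>\<^sub>1\<close> term.\<close>

lemma Lasso_bound:
  assumes x: "x \<in> carrier_vec N"
  defines "r \<equiv> l2_norm (row_mat m N c *\<^sub>v x - unit_vec m 0)"
  shows "lam / c p + lam / c p * (\<Sum>j<N. (c p - c j) * cmod (x $ j)) + (1 - lam / c p) * r
    \<le> lam * l1_norm x + r"
proof -
  let ?s = "\<Sum>j<N. of_real (c j) * x $ j"
  have r: "r = cmod (?s - 1)" unfolding r_def by (rule l2_norm_row_mat[OF m x])
  have "1 \<le> cmod ?s + r"
    using norm_triangle_ineq4[of ?s "?s - 1"] by (simp add: r)
  then have "1 - r + (\<Sum>j<N. (c p - c j) * cmod (x $ j)) \<le> c p * l1_norm x"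
    using row_l1_bound[OF x, where c = c and C = "c p"] c_nonneg by simp
  \<comment> \<open>This factor turns the right-hand side into the norm term of the
    objective.\<close>
  then have "lam / c p * (1 - r + (\<Sum>j<N. (c p - c j) * cmod (x $ j))) \<le> lam / c p * (c p * l1_norm x)"
    using lam c_pos by (intro mult_left_mono) auto
  also have "\<dots> = lam * l1_norm x" using c_pos by simp
  finally show ?thesis by (simp add: algebra_simps)
qed

text \<open>Since \<open>0 < lam < c p\<close>, the terms beyond \<open>lam / c p\<close> in the
  lower bound are nonnegative, and the spike attains \<open>lam / c p\<close>.\<close>

lemma Xi_Lasso_row_mat_nonempty: "Xi_Lasso N lam (row_mat m N c, unit_vec m 0) \<noteq> {}"
proof -
  have "lam / c p \<le> lam * l1_norm x + l2_norm (row_mat m N c *\<^sub>v x - unit_vec m 0)"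
    if "x \<in> carrier_vec N" for x
  proof -
    have "0 \<le> lam / c p * (\<Sum>j<N. (c p - c j) * cmod (x $ j))"
      using lam c_pos excess_nonneg[of x] by (intro mult_nonneg_nonneg) auto
    moreover have "0 \<le> (1 - lam / c p) * l2_norm (row_mat m N c *\<^sub>v x - unit_vec m 0)"
      using lam c_pos l2_norm_nonneg by (intro mult_nonneg_nonneg) auto
    ultimately show ?thesis using Lasso_bound[OF that] by linarith
  qed
  then have "of_real (1 / c p) \<cdot>\<^sub>v unit_vec N p \<in> Xi_Lasso N lam (row_mat m N c, unit_vec m 0)"
    unfolding Xi_Lasso_def is_arg_min_def
    using Lasso_spike_value by (simp add: not_less)
  then show ?thesis by blast
qed

text \<open>Optimality forces both surplus terms of the lower bound to vanish. The zero penalty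
  removes the entries off \<open>p\<close>; the zero residual then determines entry \<open>p\<close>
  exactly.\<close>

lemma Xi_Lasso_row_mat_concentrated:
  assumes "\<And>j. j \<noteq> p \<Longrightarrow> c j < c p" and x: "x \<in> Xi_Lasso N lam (row_mat m N c, unit_vec m 0)"
  shows "x \<in> carrier_vec N" "\<And>j. j < N \<Longrightarrow> j \<noteq> p \<Longrightarrow> x $ j = 0" "c p * Re (x $ p) = 1"
proof -
  let ?e = "\<Sum>j<N. (c p - c j) * cmod (x $ j)"
  let ?r = "l2_norm (row_mat m N c *\<^sub>v x - unit_vec m 0)"
  from x have xN: "x \<in> carrier_vec N"
    and "\<And>z. z \<in> carrier_vec N \<Longrightarrow> lam * l1_norm x + ?r
      \<le> lam * l1_norm z + l2_norm (row_mat m N c *\<^sub>v z - unit_vec m 0)"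
    by (auto simp: Xi_Lasso_def is_arg_min_def not_less)
  from this(2)[OF Lasso_spike_value(1)] have "lam * l1_norm x + ?r \<le> lam / c p"
    by (simp only: Lasso_spike_value(2))
  with Lasso_bound[OF xN] have le: "lam / c p * ?e + (1 - lam / c p) * ?r \<le> 0"
    by linarith
  have pos: "0 < lam / c p" "0 < 1 - lam / c p" using lam c_pos by auto
  have "0 \<le> lam / c p * ?e"
    by (rule mult_nonneg_nonneg[OF less_imp_le[OF pos(1)] excess_nonneg])
  moreover have "0 \<le> (1 - lam / c p) * ?r"
    by (rule mult_nonneg_nonneg[OF less_imp_le[OF pos(2)] l2_norm_nonneg])
  ultimately have "lam / c p * ?e \<le> 0" "(1 - lam / c p) * ?r \<le> 0" using le by linarith+
  then have e: "?e \<le> 0" and r: "?r \<le> 0"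
    using pos by (auto simp only: mult_le_0_iff)
  show zero: "x $ j = 0" if "j < N" "j \<noteq> p" for j
    using weighted_sum_nonpos_imp_zero[OF xN] assms(1) e that by blast
  show "x \<in> carrier_vec N" by (rule xN)
  have "of_real (c p) * x $ p - 1 = 0"
    using r row_sum_unit[OF p zero, of c] by (simp add: l2_norm_row_mat[OF m xN])
  then have "Re (of_real (c p) * x $ p - 1) = 0" by simp
  then show "c p * Re (x $ p) = 1" by simp
qed

end

end


section \<open>Nonexistence of transparent algorithms\<close>

text \<open>Two perturbations of one input, favouring columns 0 and 1, have solutions whose first
  entries stay apart, contradicting continuity. The bound \<open>3 / 4\<close> suits both problems:
  basis pursuit gives \<open>1 - \<epsilon>\<close>, Lasso gives 1.\<close>

lemma not_transparently_solvable_if_concentrated: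
  fixes f :: "complex mat \<times> complex vec \<Rightarrow> complex vec set"
  assumes N: "2 \<le> N"
    and nonempty: "\<And>c p. p < N \<Longrightarrow> (\<And>j. 0 \<le> c j) \<Longrightarrow> (\<And>j. c j \<le> c p) \<Longrightarrow> 2 \<le> c p
      \<Longrightarrow> f (row_mat m N c, unit_vec m 0) \<noteq> {}"
    and concentrated: "\<And>c p x. p < N \<Longrightarrow> (\<And>j. 0 \<le> c j) \<Longrightarrow> (\<And>j. j \<noteq> p \<Longrightarrow> c j < c p) \<Longrightarrow> 2 \<le> c p
      \<Longrightarrow> x \<in> f (row_mat m N c, unit_vec m 0)
      \<Longrightarrow> x \<in> carrier_vec N \<and> (\<forall>j<N. j \<noteq> p \<longrightarrow> x $ j = 0) \<and> 3 / 4 \<le> c p * Re (x $ p)"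
  shows "\<not> (\<exists>M. transparently_solves input_coords vec_coords (2 * N) M (problem_inputs m N) f)"
proof
  assume "\<exists>M. transparently_solves input_coords vec_coords (2 * N) M (problem_inputs m N) f"
  then obtain M g where g_sel: "g \<in> selections (problem_inputs m N) f"
    and g: "realizes input_coords vec_coords (2 * N) M (set_dom (problem_inputs m N) f) g"
    unfolding transparently_solves_def by blast
  let ?inp = "\<lambda>c. (row_mat m N c, unit_vec m 0 :: complex vec)"
  let ?D = "set_dom (problem_inputs m N) f"
  \<comment> \<open>The critical row: columns 0 and 1 are tied.\<close>
  define b where "b j = (if j < 2 then 2 else 0 :: real)" for j :: nat
  have dom: "?inp c \<in> ?D" if "p < N" "\<And>j. 0 \<le> c j" "\<And>j. c j \<le> c p" "2 \<le> c p" for c p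
    using nonempty[of p c] that by (auto simp: set_dom_def problem_inputs_def row_mat_def)
  have "list_all2 (\<lambda>x x'. x \<in> \<rat>) (input_coords (?inp b)) (input_coords (?inp b))"
    by (rule list_all2_input_coords_row_mat) (auto simp: b_def)
  then have rat: "set (input_coords (?inp b)) \<subseteq> \<rat>"
    by (auto simp: list_all2_same)
  have "?inp b \<in> ?D"
    by (rule dom[where p = 0]) (use N in \<open>auto simp: b_def\<close>)
  \<comment> \<open>Two inputs near \<open>b\<close> then have values at most \<open>1 / 8\<close>
    apart, below the gap \<open>1 / 4\<close> found later.\<close>
  from realized_continuous_at_rational[OF g this rat, of 0 "1 / 16"] N
  obtain K where K: "\<And>v. v \<in> ?D
      \<Longrightarrow> list_all2 (\<lambda>x x'. x' \<in> \<rat> \<and> \<bar>x - x'\<bar> \<le> 1 / 2 ^ K) (input_coords (?inp b)) (input_coords v)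
      \<Longrightarrow> \<bar>vec_coords (g v) ! 0 - vec_coords (g (?inp b)) ! 0\<bar> \<le> 1 / 16"
    by auto
  \<comment> \<open>For \<open>p < 2\<close> this breaks the tie in favour of \<open>p\<close> by a
    rational amount just within the tolerance.\<close>
  define c where "c p = b(p := 2 + 1 / 2 ^ K)" for p
  have c: "(\<forall>j. 0 \<le> c p j) \<and> (\<forall>j. j \<noteq> p \<longrightarrow> c p j < c p p) \<and> 2 \<le> c p p" for p
    by (auto simp: c_def b_def add_pos_pos)
  have near: "\<bar>vec_coords (g (?inp (c p))) ! 0 - vec_coords (g (?inp b)) ! 0\<bar> \<le> 1 / 16"
    and sel: "g (?inp (c p)) \<in> f (?inp (c p))" if p: "p < 2" for p
  proof -
    have "c p j \<le> c p p" for j using c[of p] by (cases "j = p") (auto intro: less_imp_le)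
    then have D: "?inp (c p) \<in> ?D"
      by (intro dom[where p = p]) (use c N p in auto)
    show "g (?inp (c p)) \<in> f (?inp (c p))"
      using g_sel D by (auto simp: selections_def)
    show "\<bar>vec_coords (g (?inp (c p))) ! 0 - vec_coords (g (?inp b)) ! 0\<bar> \<le> 1 / 16"
      by (rule K[OF D], rule list_all2_input_coords_row_mat) (use p in \<open>auto simp: c_def b_def\<close>)
  qed
  have coord: "vec_coords x ! 0 = Re (x $ 0)" if "x \<in> carrier_vec N" for x
  proof -
    have "length (list_of_vec x) = N" using that by simp
    then obtain a l where l: "list_of_vec x = a # l"
      using N by (cases "list_of_vec x") auto
    have "a = x $ 0"
      using list_of_vec_index[of x 0] that N by (simp add: l)
    then show ?thesis
      by (simp add: vec_coords_def l)
  qed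
  have conc: "g (?inp (c p)) \<in> carrier_vec N
      \<and> (\<forall>j<N. j \<noteq> p \<longrightarrow> g (?inp (c p)) $ j = 0) \<and> 3 / 4 \<le> c p p * Re (g (?inp (c p)) $ p)"
    if "p < 2" for p
    by (rule concentrated) (use c N sel that in auto)
  define t where "t = Re (g (?inp (c 0)) $ 0)"
  have "3 / 4 \<le> c 0 0 * t" using conc[of 0] by (simp add: t_def)
  \<comment> \<open>The perturbation is at most 1, so dividing \<open>3 / 4\<close> by the entry
    still leaves \<open>1 / 4\<close>.\<close>
  moreover have "c 0 0 \<le> 3" "0 < c 0 0" by (auto simp: c_def add_pos_pos)
  moreover have "c 0 0 * t < c 0 0 * (1 / 4)" if "t < 1 / 4"
    using that \<open>0 < c 0 0\<close> by (rule mult_strict_left_mono)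
  ultimately have "1 / 4 \<le> t" by linarith
  moreover have "vec_coords (g (?inp (c 0))) ! 0 = t" "vec_coords (g (?inp (c 1))) ! 0 = 0"
    using conc[of 0] conc[of 1] N by (auto simp: coord t_def)
  ultimately show False
    using near[of 0] near[of 1] by simp
qed

theorem corollary4p7:
  fixes m N :: nat and \<epsilon> lam :: real
  assumes "N \<ge> 2" and "1 \<le> m" and "m < N"
    and "0 < \<epsilon>" and "\<epsilon> < 1 / 4"
    and "0 < lam" and "lam < 5 / 4" and "lam \<in> \<rat>"
  shows "\<not> (\<exists>M. transparently_solves input_coords vec_coords (2 * N) M
              (problem_inputs m N) (Xi_BP N \<epsilon>))
    \<and> \<not> (\<exists>M. transparently_solves input_coords vec_coords (2 * N) M
              (problem_inputs m N) (Xi_Lasso N lam))"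
proof
  have m: "0 < m" using assms by simp
  show "\<not> (\<exists>M. transparently_solves input_coords vec_coords (2 * N) M
              (problem_inputs m N) (Xi_BP N \<epsilon>))"
  \<comment> \<open>The bound \<open>\<epsilon> < 1 / 4\<close> gives
    \<open>3 / 4 \<le> 1 - \<epsilon>\<close>.\<close>
  proof (rule not_transparently_solvable_if_concentrated[OF assms(1)], goal_cases)
    case (1 c p)
    then show ?case using Xi_BP_row_mat_nonempty[OF m, of p N c \<epsilon>] assms by simp
  next
    case (2 c p x)
    then have "c j \<le> c p" for j by (cases "j = p") (auto intro: less_imp_le)
    with 2 show ?case using Xi_BP_row_mat_concentrated[OF m, of p N c \<epsilon> x] assms by force
  qed
  show "\<not> (\<exists>M. transparently_solves input_coords vec_coords (2 * N) M
              (problem_inputs m N) (Xi_Lasso N lam))"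
  \<comment> \<open>Here \<open>lam < 5 / 4 < 2 \<le> c p\<close> supplies the condition
    \<open>lam < c p\<close>.\<close>
  proof (rule not_transparently_solvable_if_concentrated[OF assms(1)], goal_cases)
    case (1 c p)
    then show ?case using Xi_Lasso_row_mat_nonempty[OF m, of p N c lam] assms by simp
  next
    case (2 c p x)
    then have "c j \<le> c p" for j by (cases "j = p") (auto intro: less_imp_le)
    with 2 show ?case using Xi_Lasso_row_mat_concentrated[OF m, of p N c lam x] assms by force
  qed
qed

end
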